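(* For all integers $r\geq2$, $\mathcal{B}_{r,1}=\mathcal{D}_{r,1}$.
   Context: A partition is a non-increasing finite sequence of positive integers (possibly empty). For a partition $\mu=(\mu_1,\dots,\mu_t)$ let $\mathrm{rect}(\mu)=\max\{h\ge0: h\le t,\ \mu_h\ge h+1\}$ (height of the horizontal Durfee rectangle, the largest rectangle with $h$ rows and $h+1$ columns in the top-left corner of the Young diagram). $\mathcal{D}_{r,1}$ is the set of partitions $\lambda$ such that, setting $\mu^{(0)}=\lambda$ and letting $\mu^{(j)}$ be $\mu^{(j-1)}$ with its first $\mathrm{rect}(\mu^{(j-1)})$ parts deleted, $\mu^{(r-1)}$ is empty. $\mathcal{B}_{r,1}$ is the set of partitions $\lambda$ such that, setting $\nu^{(0)}=\lambda$ and letting $\nu^{(j)}$ be obtained from $\nu^{(j-1)}=(\nu_1,\dots,\nu_t)$ by deleting its last $\min(\nu_t-1,t)$ parts (removal of the bottom rectangle of width $\nu_t$ and height $\nu_t-1$; nothing is done if $\nu^{(j-1)}$ is empty), $\nu^{(r-1)}$ is empty. *)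

theory Defs
  imports Main
begin

definition is_partition :: "nat list \<Rightarrow> bool" where
  "is_partition \<mu> \<longleftrightarrow> sorted_wrt (\<ge>) \<mu> \<and> (\<forall>p\<in>set \<mu>. 0 < p)"

text \<open>Lists are indexed from 0, so the part \<open>\<mu>\<^sub>h\<close> is \<open>\<mu> ! (h - 1)\<close>;
  the condition on \<open>\<mu>\<^sub>h\<close> is vacuous for \<open>h = 0\<close>.\<close>

definition rect :: "nat list \<Rightarrow> nat" where
  "rect \<mu> = Max {h. h \<le> length \<mu> \<and> (h \<ge> 1 \<longrightarrow> \<mu> ! (h - 1) \<ge> h + 1)}"

definition remove_top_rect :: "nat list \<Rightarrow> nat list" where
  "remove_top_rect \<mu> = drop (rect \<mu>) \<mu>"

definition D_set :: "nat \<Rightarrow> nat list set" where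
  "D_set r = {la. is_partition la \<and> (remove_top_rect ^^ (r - 1)) la = []}"

definition remove_bottom_rect :: "nat list \<Rightarrow> nat list" where
  "remove_bottom_rect \<nu> =
     (if \<nu> = [] then [] else take (length \<nu> - min (last \<nu> - 1) (length \<nu>)) \<nu>)"

definition B_set :: "nat \<Rightarrow> nat list set" where
  "B_set r = {la. is_partition la \<and> (remove_bottom_rect ^^ (r - 1)) la = []}"

end

theory Submission
  imports Defs "HOL-Library.Sublist"
begin

text \<open>Call a list of parts a block if it has fewer entries than its smallest part. Every
  subsequence of a block is again a block. Removing the top rectangle deletes the longest prefix
  that is a block, removing the bottom rectangle the longest suffix that is a block. Either greedy
  procedure empties a partition within \<open>k\<close> steps iff the partition is a concatenation of \<open>k\<close>
  (possibly empty) blocks, a condition that does not see the direction of removal.\<close>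

definition subseq_closed :: "('a list \<Rightarrow> bool) \<Rightarrow> bool" where
  "subseq_closed P \<longleftrightarrow> (\<forall>xs ys. subseq xs ys \<longrightarrow> P ys \<longrightarrow> P xs)"

definition splits_into :: "('a list \<Rightarrow> bool) \<Rightarrow> nat \<Rightarrow> 'a list \<Rightarrow> bool" where
  "splits_into P k xs \<longleftrightarrow> (\<exists>bs. length bs = k \<and> concat bs = xs \<and> (\<forall>b\<in>set bs. P b))"

lemma splits_into_0 [simp]: "splits_into P 0 xs \<longleftrightarrow> xs = []"
  by (auto simp: splits_into_def)

lemma splits_into_Suc_prefix:
  "splits_into P (Suc k) xs \<longleftrightarrow> (\<exists>b ys. xs = b @ ys \<and> P b \<and> splits_into P k ys)"
  unfolding splits_into_def length_Suc_conv by fastforce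

lemma splits_into_Suc_suffix:
  "splits_into P (Suc k) xs \<longleftrightarrow> (\<exists>ys b. xs = ys @ b \<and> P b \<and> splits_into P k ys)"
  unfolding splits_into_def length_Suc_conv_rev by fastforce

lemma splits_into_subseq:
  assumes "subseq_closed P" "splits_into P k ys" "subseq xs ys"
  shows "splits_into P k xs"
  using assms(2,3)
proof (induction k arbitrary: xs ys)
  case (Suc k)
  then obtain b zs where "ys = b @ zs" "P b" "splits_into P k zs"
    by (auto simp: splits_into_Suc_prefix)
  moreover from this(1) Suc.prems(2) obtain us vs
    where "xs = us @ vs" "subseq us b" "subseq vs zs"
    by (auto elim: subseq_appendE)
  ultimately show ?case
    using Suc.IH assms(1) unfolding splits_into_Suc_prefix subseq_closed_def by blast
qed simp

lemma splits_into_drop_longest_prefix: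
  assumes "subseq_closed P" "P (take n xs)"
    and longest: "\<And>b ys. xs = b @ ys \<Longrightarrow> P b \<Longrightarrow> length b \<le> n"
  shows "splits_into P k (drop n xs) \<longleftrightarrow> splits_into P (Suc k) xs"
proof
  assume "splits_into P k (drop n xs)"
  then show "splits_into P (Suc k) xs"
    using assms(2) unfolding splits_into_Suc_prefix by (metis append_take_drop_id)
next
  assume "splits_into P (Suc k) xs"
  then obtain b ys where b: "xs = b @ ys" "P b" "splits_into P k ys"
    by (auto simp: splits_into_Suc_prefix)
  then have "drop n xs = drop (n - length b) ys"
    using longest by simp
  then have "subseq (drop n xs) ys"
    by (metis suffix_drop suffix_imp_subseq)
  with assms(1) b(3) show "splits_into P k (drop n xs)"
    by (rule splits_into_subseq)
qed

lemma splits_into_take_longest_suffix: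
  assumes "subseq_closed P" "P (drop n xs)"
    and longest: "\<And>ys b. xs = ys @ b \<Longrightarrow> P b \<Longrightarrow> n \<le> length ys"
  shows "splits_into P k (take n xs) \<longleftrightarrow> splits_into P (Suc k) xs"
proof
  assume "splits_into P k (take n xs)"
  then show "splits_into P (Suc k) xs"
    using assms(2) unfolding splits_into_Suc_suffix by (metis append_take_drop_id)
next
  assume "splits_into P (Suc k) xs"
  then obtain ys b where b: "xs = ys @ b" "P b" "splits_into P k ys"
    by (auto simp: splits_into_Suc_suffix)
  then have "take n xs = take n ys"
    using longest by simp
  then have "subseq (take n xs) ys"
    by (metis prefix_imp_subseq take_is_prefix)
  with assms(1) b(3) show "splits_into P k (take n xs)"
    by (rule splits_into_subseq)
qed

lemma funpow_eq_Nil_iff_splits_into: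
  assumes invariant: "\<And>xs. I xs \<Longrightarrow> I (f xs)"
    and step: "\<And>k xs. I xs \<Longrightarrow> splits_into P k (f xs) \<longleftrightarrow> splits_into P (Suc k) xs"
    and "I xs"
  shows "(f ^^ k) xs = [] \<longleftrightarrow> splits_into P k xs"
  using \<open>I xs\<close>
proof (induction k arbitrary: xs)
  case (Suc k)
  then have "(f ^^ k) (f xs) = [] \<longleftrightarrow> splits_into P k (f xs)"
    using invariant by blast
  then show ?case
    using step[OF Suc.prems] by (simp add: funpow_swap1)
qed simp

definition rect_block :: "nat list \<Rightarrow> bool" where
  "rect_block xs \<longleftrightarrow> (\<forall>x\<in>set xs. length xs < x)"

lemma subseq_closed_rect_block: "subseq_closed rect_block"
proof -
  have "rect_block xs" if "subseq xs ys" "rect_block ys" for xs ys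
  proof -
    have "length xs \<le> length ys" using that(1) by (rule list_emb_length)
    moreover have "set xs \<subseteq> set ys" using that(1) by (auto elim: list_emb_set)
    ultimately show ?thesis using that(2) by (auto simp: rect_block_def intro: le_less_trans)
  qed
  then show ?thesis by (auto simp: subseq_closed_def)
qed

lemma rect_block_iff_length_less_last:
  assumes "sorted_wrt (\<ge>) xs" "xs \<noteq> []"
  shows "rect_block xs \<longleftrightarrow> length xs < last xs"
proof -
  have "last xs \<le> x" if "x \<in> set xs" for x
    using assms that by (cases xs rule: rev_cases) (auto simp: sorted_wrt_append)
  moreover have "last xs \<in> set xs"
    using assms(2) by simp
  ultimately show ?thesis
    unfolding rect_block_def by (meson less_le_trans)
qed

lemma rect_block_take_iff:
  assumes "sorted_wrt (\<ge>) \<mu>" "h \<le> length \<mu>"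
  shows "rect_block (take h \<mu>) \<longleftrightarrow> (h \<ge> 1 \<longrightarrow> \<mu> ! (h - 1) \<ge> h + 1)"
proof (cases "h = 0")
  case False
  then have nonempty: "take h \<mu> \<noteq> []"
    using assms(2) by auto
  then have "last (take h \<mu>) = \<mu> ! (h - 1)"
    using assms(2) False by (simp add: last_conv_nth)
  then show ?thesis
    using assms False nonempty rect_block_iff_length_less_last[of "take h \<mu>"]
    by (auto simp: Suc_le_eq)
qed (simp add: rect_block_def)

lemma rect_eq_Max_rect_block:
  assumes "sorted_wrt (\<ge>) \<mu>"
  shows "rect \<mu> = Max {h. h \<le> length \<mu> \<and> rect_block (take h \<mu>)}"
  unfolding rect_def using rect_block_take_iff[OF assms] by (metis (lifting))

lemma rect_block_drop_iff:
  assumes "sorted_wrt (\<ge>) \<nu>" "\<nu> \<noteq> []"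
  shows "rect_block (drop m \<nu>) \<longleftrightarrow> length \<nu> - min (last \<nu> - 1) (length \<nu>) \<le> m"
proof (cases "m < length \<nu>")
  case True
  then have "rect_block (drop m \<nu>) \<longleftrightarrow> length \<nu> - m < last \<nu>"
    using assms(1) rect_block_iff_length_less_last[of "drop m \<nu>"] by simp
  with True show ?thesis by auto
qed (simp add: rect_block_def)

lemma splits_into_remove_top_rect:
  assumes "sorted_wrt (\<ge>) \<mu>"
  shows "splits_into rect_block k (remove_top_rect \<mu>) \<longleftrightarrow> splits_into rect_block (Suc k) \<mu>"
proof -
  let ?H = "{h. h \<le> length \<mu> \<and> rect_block (take h \<mu>)}"
  have "finite ?H" by simp
  moreover have "0 \<in> ?H" by (simp add: rect_block_def)
  ultimately have "rect \<mu> \<in> ?H"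
    unfolding rect_eq_Max_rect_block[OF assms] by (intro Max_in) auto
  moreover have "length b \<le> rect \<mu>" if "\<mu> = b @ ys" "rect_block b" for b ys
    unfolding rect_eq_Max_rect_block[OF assms] using that by (intro Max_ge) simp_all
  ultimately show ?thesis
    unfolding remove_top_rect_def
    by (intro splits_into_drop_longest_prefix subseq_closed_rect_block) auto
qed

lemma splits_into_remove_bottom_rect:
  assumes "sorted_wrt (\<ge>) \<nu>"
  shows "splits_into rect_block k (remove_bottom_rect \<nu>) \<longleftrightarrow> splits_into rect_block (Suc k) \<nu>"
proof -
  define m where "m = (if \<nu> = [] then 0 else length \<nu> - min (last \<nu> - 1) (length \<nu>))"
  have block_iff: "rect_block (drop j \<nu>) \<longleftrightarrow> m \<le> j" for j
    using rect_block_drop_iff[OF assms] by (simp add: m_def rect_block_def)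
  have "m \<le> length ys" if "\<nu> = ys @ b" "rect_block b" for ys b
    using that block_iff[of "length ys"] by simp
  moreover have "remove_bottom_rect \<nu> = take m \<nu>"
    by (simp add: remove_bottom_rect_def m_def)
  ultimately show ?thesis
    using block_iff by (simp add: splits_into_take_longest_suffix subseq_closed_rect_block)
qed

lemma remove_top_rect_funpow_eq_Nil_iff:
  assumes "sorted_wrt (\<ge>) \<mu>"
  shows "(remove_top_rect ^^ k) \<mu> = [] \<longleftrightarrow> splits_into rect_block k \<mu>"
proof (rule funpow_eq_Nil_iff_splits_into[where I = "sorted_wrt (\<ge>)"])
  show "sorted_wrt (\<ge>) (remove_top_rect \<nu>)" if "sorted_wrt (\<ge>) \<nu>" for \<nu>
    using that by (simp add: remove_top_rect_def)
qed (use assms splits_into_remove_top_rect in auto)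

lemma remove_bottom_rect_funpow_eq_Nil_iff:
  assumes "sorted_wrt (\<ge>) \<nu>"
  shows "(remove_bottom_rect ^^ k) \<nu> = [] \<longleftrightarrow> splits_into rect_block k \<nu>"
proof (rule funpow_eq_Nil_iff_splits_into[where I = "sorted_wrt (\<ge>)"])
  show "sorted_wrt (\<ge>) (remove_bottom_rect \<mu>)" if "sorted_wrt (\<ge>) \<mu>" for \<mu>
    using that by (simp add: remove_bottom_rect_def)
qed (use assms splits_into_remove_bottom_rect in auto)

theorem theorem3p5:
  fixes r :: nat
  assumes "r \<ge> 2"
  shows "B_set r = D_set r"
proof -
  have "(remove_bottom_rect ^^ (r - 1)) la = [] \<longleftrightarrow> (remove_top_rect ^^ (r - 1)) la = []"
    if "sorted_wrt (\<ge>) la" for la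
    using that by (simp add: remove_bottom_rect_funpow_eq_Nil_iff remove_top_rect_funpow_eq_Nil_iff)
  then show ?thesis
    by (auto simp: B_set_def D_set_def is_partition_def)
qed

end
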